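(* Let $R$ be a Dedekind domain with quotient field $K$. Then the connected components of $GCl(R)$ are in one-to-one correspondence with the elements of the class group $\operatorname{Cl}(R)$, and likewise the connected components of $GCl_{int}(R)$ are in one-to-one correspondence with the elements of $\operatorname{Cl}(R)$. Each connected component of $GCl(R)$ is complete, each connected component of $GCl_{int}(R)$ has diameter no more than $2$, and the connected components of $GCl_{int}(R)$ are complete if and only if $R$ is a local PID.
   Context: Both graphs are simple undirected graphs whose vertices are the nonzero ideals of $R$ (including $R$ itself). In $GCl(R)$ there is an edge between two distinct nonzero ideals $I$ and $J$ if and only if there is a nonzero $k\in K$ such that $I=Jk$. In $GCl_{int}(R)$ there is an edge between two distinct nonzero ideals if and only if, for one of the two orderings $(I,J)$ of the pair, there is a nonzero $a\in R$ such that $I=Ja$. *)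

theory Defs
  imports
    "Graph_Theory.Graph_Theory"
    "HOL-Algebra.Algebra"
begin

section \<open>Dedekind domains and their quotient fields\<close>

text \<open>
  The domain \<open>R\<close> is regarded as a subring of its quotient field \<open>K\<close>: both are structures over the
  same type and the operations of \<open>R\<close> are those of \<open>K\<close>.
\<close>

definition quotient_field :: "('a, 'b) ring_scheme \<Rightarrow> ('a, 'b) ring_scheme \<Rightarrow> bool" where
  "quotient_field R K \<longleftrightarrow>
     field K \<and> subring (carrier R) K \<and> R = K\<lparr>carrier := carrier R\<rparr> \<and>
     (\<forall>x\<in>carrier K. \<exists>a\<in>carrier R. \<exists>b\<in>carrier R - {\<zero>\<^bsub>K\<^esub>}. x = a \<otimes>\<^bsub>K\<^esub> inv\<^bsub>K\<^esub> b)"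

text \<open>
  Polynomials in HOL-Algebra are coefficient lists with the leading coefficient first;
  \<open>univ_poly K A\<close> consists of the polynomials over \<open>K\<close> with all coefficients in \<open>A\<close>.
\<close>

definition integral_over :: "('a, 'b) ring_scheme \<Rightarrow> 'a set \<Rightarrow> 'a \<Rightarrow> bool" where
  "integral_over K A x \<longleftrightarrow>
     (\<exists>p\<in>carrier (univ_poly K A). p \<noteq> [] \<and> lead_coeff p = \<one>\<^bsub>K\<^esub> \<and> ring.eval K p x = \<zero>\<^bsub>K\<^esub>)"

text \<open>
  To be used with \<open>K\<close> the quotient field of \<open>R\<close>. Fields count as Dedekind domains.
\<close>

definition dedekind_domain :: "('a, 'b) ring_scheme \<Rightarrow> ('a, 'b) ring_scheme \<Rightarrow> bool" where
  "dedekind_domain R K \<longleftrightarrow>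
     noetherian_domain R \<and>
     (\<forall>x\<in>carrier K. integral_over K (carrier R) x \<longrightarrow> x \<in> carrier R) \<and>
     (\<forall>P. primeideal P R \<and> P \<noteq> {\<zero>\<^bsub>R\<^esub>} \<longrightarrow> maximalideal P R)"

definition local_ring :: "('a, 'b) ring_scheme \<Rightarrow> bool" where
  "local_ring R \<longleftrightarrow> cring R \<and> (\<exists>!M. maximalideal M R)"

section \<open>The class group\<close>

definition fractional_ideal ::
  "('a, 'b) ring_scheme \<Rightarrow> ('a, 'b) ring_scheme \<Rightarrow> 'a set \<Rightarrow> bool" where
  "fractional_ideal R K I \<longleftrightarrow>
     additive_subgroup I K \<and> (\<forall>r\<in>carrier R. \<forall>x\<in>I. r \<otimes>\<^bsub>K\<^esub> x \<in> I) \<and>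
     I \<noteq> {\<zero>\<^bsub>K\<^esub>} \<and>
     (\<exists>d\<in>carrier R - {\<zero>\<^bsub>R\<^esub>}. \<forall>x\<in>I. d \<otimes>\<^bsub>K\<^esub> x \<in> carrier R)"

text \<open>
  The set \<open>ideal_prod K I J\<close> consists of the finite sums of products of an element of \<open>I\<close> and an
  element of \<open>J\<close>, computed in \<open>K\<close>.
\<close>

definition fractional_ideal_group ::
  "('a, 'b) ring_scheme \<Rightarrow> ('a, 'b) ring_scheme \<Rightarrow> 'a set monoid" where
  "fractional_ideal_group R K =
     \<lparr>carrier = {I. fractional_ideal R K I}, mult = ideal_prod K, one = carrier R\<rparr>"

text \<open>
  For a ring \<open>K\<close>, the library's right coset \<open>J #>\<^bsub>K\<^esub> k\<close> is formed with the
  multiplication of \<open>K\<close>, so it is the dilate \<open>Jk = {j \<otimes> k | j \<in> J}\<close>.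
\<close>

definition principal_fractional_ideals ::
  "('a, 'b) ring_scheme \<Rightarrow> ('a, 'b) ring_scheme \<Rightarrow> 'a set set" where
  "principal_fractional_ideals R K = {carrier R #>\<^bsub>K\<^esub> x | x. x \<in> carrier K - {\<zero>\<^bsub>K\<^esub>}}"

definition class_group ::
  "('a, 'b) ring_scheme \<Rightarrow> ('a, 'b) ring_scheme \<Rightarrow> 'a set set monoid" where
  "class_group R K = fractional_ideal_group R K Mod principal_fractional_ideals R K"

definition ideal_class ::
  "('a, 'b) ring_scheme \<Rightarrow> ('a, 'b) ring_scheme \<Rightarrow> 'a set \<Rightarrow> 'a set set" where
  "ideal_class R K I =
     principal_fractional_ideals R K #>\<^bsub>fractional_ideal_group R K\<^esub> I"

section \<open>The graphs\<close>

definition nonzero_ideals :: "('a, 'b) ring_scheme \<Rightarrow> 'a set set" where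
  "nonzero_ideals R = {I. ideal I R \<and> I \<noteq> {\<zero>\<^bsub>R\<^esub>}}"

text \<open>
  A simple undirected graph is represented, following the library, by a symmetric loop-free
  digraph whose arcs are pairs of vertices. The relation in \<open>GCl\<close> is symmetric because
  \<open>I = Jk\<close> gives \<open>J = I(inv k)\<close> (see \<open>symmetric_GCl\<close> below).
\<close>

definition GCl ::
  "('a, 'b) ring_scheme \<Rightarrow> ('a, 'b) ring_scheme \<Rightarrow> ('a set, 'a set \<times> 'a set) pre_digraph" where
  "GCl R K = with_proj \<lparr>
     pverts = nonzero_ideals R,
     parcs = {(I, J). I \<in> nonzero_ideals R \<and> J \<in> nonzero_ideals R \<and> I \<noteq> J \<and>
                (\<exists>k\<in>carrier K - {\<zero>\<^bsub>K\<^esub>}. I = J #>\<^bsub>K\<^esub> k)}\<rparr>"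

definition GCl_int ::
  "('a, 'b) ring_scheme \<Rightarrow> ('a set, 'a set \<times> 'a set) pre_digraph" where
  "GCl_int R = with_proj \<lparr>
     pverts = nonzero_ideals R,
     parcs = {(I, J). I \<in> nonzero_ideals R \<and> J \<in> nonzero_ideals R \<and> I \<noteq> J \<and>
                (\<exists>a\<in>carrier R - {\<zero>\<^bsub>R\<^esub>}. I = J #>\<^bsub>R\<^esub> a \<or> J = I #>\<^bsub>R\<^esub> a)}\<rparr>"

text \<open>
  For symmetric digraphs, the strongly connected components are the connected components of the
  undirected graph; they are (induced) subgraphs.
\<close>

abbreviation components :: "('v, 'e) pre_digraph \<Rightarrow> ('v, 'e) pre_digraph set" where
  "components G \<equiv> pre_digraph.sccs G"

text \<open>
  The library's \<open>complete_digraph\<close> only covers finite graphs.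
\<close>

definition complete_graph :: "('v, 'e) pre_digraph \<Rightarrow> bool" where
  "complete_graph G \<longleftrightarrow> arcs_ends G = {(u, v). u \<in> verts G \<and> v \<in> verts G \<and> u \<noteq> v}"

text \<open>
  With all weights 1, \<open>\<mu>\<close> is the length of a shortest walk (\<open>\<infinity>\<close> if there is none).
\<close>

definition graph_distance :: "('v, 'e) pre_digraph \<Rightarrow> 'v \<Rightarrow> 'v \<Rightarrow> ereal" where
  "graph_distance G u v = wf_digraph.\<mu> G (\<lambda>_. 1) u v"

definition diameter :: "('v, 'e) pre_digraph \<Rightarrow> ereal" where
  "diameter G = (SUP (u, v)\<in>verts G \<times> verts G. graph_distance G u v)"

lemma symmetric_GCl:
  assumes "quotient_field R K"
  shows "symmetric (GCl R K)"
proof -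
  interpret K: field K
    using assms by (simp add: quotient_field_def)
  have R: "R = K\<lparr>carrier := carrier R\<rparr>" and sub: "subring (carrier R) K"
    using assms by (auto simp: quotient_field_def)
  have "J = I #>\<^bsub>K\<^esub> inv\<^bsub>K\<^esub> k" "inv\<^bsub>K\<^esub> k \<in> carrier K - {\<zero>\<^bsub>K\<^esub>}"
    if J: "J \<in> nonzero_ideals R" and k: "k \<in> carrier K - {\<zero>\<^bsub>K\<^esub>}" and I: "I = J #>\<^bsub>K\<^esub> k"
    for I J k
  proof -
    have unit: "k \<in> Units K"
      using k K.field_Units by simp
    have "J \<subseteq> carrier R"
      using J additive_subgroup.a_subset by (auto simp: nonzero_ideals_def ideal_def)
    then have "J \<subseteq> carrier K"
      using subring.axioms(1)[OF sub] subgroup.subset by fastforce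
    then have "(j \<otimes>\<^bsub>K\<^esub> k) \<otimes>\<^bsub>K\<^esub> inv\<^bsub>K\<^esub> k = j" if "j \<in> J" for j
      using that k unit by (simp add: K.m_assoc subset_eq)
    then show "J = I #>\<^bsub>K\<^esub> inv\<^bsub>K\<^esub> k"
      unfolding I r_coset_def by auto
    show "inv\<^bsub>K\<^esub> k \<in> carrier K - {\<zero>\<^bsub>K\<^esub>}"
      using unit K.Units_inv_Units K.field_Units by blast
  qed
  then show ?thesis
    unfolding symmetric_def GCl_def with_proj_simps sym_def by fastforce
qed

lemma symmetric_GCl_int: "symmetric (GCl_int R)"
  unfolding symmetric_def GCl_int_def with_proj_simps sym_def by auto

end

theory Submission
  imports Defs
begin

text \<open>
  The class of a fractional ideal \<open>I\<close> is its orbit \<open>{Ik | k \<in> K, k \<noteq> 0}\<close> under dilation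
  (\<open>ideal_class_eq_orbit\<close>), because the product of \<open>I\<close> with the principal fractional ideal
  \<open>Rk\<close> is the dilate \<open>Ik\<close>. So two nonzero ideals have the same class iff one is a dilate of the
  other. Clearing denominators moves a fractional ideal into \<open>R\<close> within its orbit, so every class
  contains a nonzero ideal (\<open>carrier_class_group\<close>).

  Edges of \<open>GCl\<close> join exactly the distinct ideals of equal class. Edges of \<open>GCl_int\<close> preserve
  the class as well. If \<open>I = Jk\<close> with \<open>k = a/b\<close>, then \<open>Ib = Ja\<close> is an ideal adjacent to (or equal
  to) both \<open>I\<close> and \<open>J\<close>, so ideals of equal class are at distance at most \<open>2\<close> in \<open>GCl_int\<close>
  (\<open>GCl_int_path\<close>). In both graphs the components are therefore the fibres of the class map, and the
  bijections with the class group, the completeness of the components of \<open>GCl\<close> and the diameter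
  bound follow from general facts about such graphs (\<open>digraph_with_invariant\<close>).

  All nonzero principal ideals have the class of \<open>R\<close>. If the components of \<open>GCl_int\<close> are complete,
  any two principal ideals are thus comparable, that is, of two elements of \<open>R\<close> one always divides
  the other. In a noetherian domain this forces every ideal to be principal and any two maximal ideals
  to be equal (\<open>principal_if_divides_total\<close>, \<open>local_if_divides_total\<close>). Conversely, divisibility
  is total in a local principal ideal domain (\<open>divides_total_if_local\<close>), and if \<open>b = ac\<close>, then
  \<open>Rb = (Ra)c\<close> is equal or adjacent to \<open>Ra\<close>.
\<close>

section \<open>Components of a graph as the fibres of an invariant\<close>

lemma induced_subgraph_arcs_ends:
  assumes "induced_subgraph H G"
  shows "arcs_ends H = {(u, v) \<in> arcs_ends G. u \<in> verts H \<and> v \<in> verts H}"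
  using assms unfolding induced_subgraph_def subgraph_def compatible_def arcs_ends_conv by auto

text \<open>
  A function on the vertices whose fibres are the classes of mutually reachable vertices. It stands
  for the ideal class, which serves both graphs.
\<close>

locale digraph_with_invariant = loopfree_digraph +
  fixes \<phi> :: "'a \<Rightarrow> 'c"
  assumes invariant_adj: "u \<rightarrow>\<^bsub>G\<^esub> v \<Longrightarrow> \<phi> u = \<phi> v"
    and reachable_if_invariant_eq:
      "\<lbrakk>u \<in> verts G; v \<in> verts G; \<phi> u = \<phi> v\<rbrakk> \<Longrightarrow> u \<rightarrow>\<^sup>* v"
begin

lemma reachable_iff_invariant_eq:
  "u \<rightarrow>\<^sup>* v \<longleftrightarrow> u \<in> verts G \<and> v \<in> verts G \<and> \<phi> u = \<phi> v"
proof -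
  have "\<phi> u = \<phi> v" if "u \<rightarrow>\<^sup>* v"
    using that by (induct rule: reachable_induct) (auto dest: invariant_adj)
  then show ?thesis
    by (auto intro: reachable_if_invariant_eq dest: reachable_in_verts)
qed

lemma scc_of_eq_fibre: "u \<in> verts G \<Longrightarrow> scc_of u = {v \<in> verts G. \<phi> v = \<phi> u}"
  unfolding scc_of_def reachable_iff_invariant_eq by auto

lemma verts_component:
  assumes "C \<in> sccs" "u \<in> verts C"
  shows "verts C = {v \<in> verts G. \<phi> v = \<phi> u}"
proof -
  have "verts C \<in> sccs_verts"
    using assms(1) by (simp add: sccs_verts_conv)
  then obtain w where "w \<in> verts G" "verts C = scc_of w"
    by (auto simp: sccs_verts_conv_scc_of)
  then show ?thesis
    using assms(2) by (auto simp: scc_of_eq_fibre)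
qed

lemma component_of_vertex:
  assumes "u \<in> verts G"
  obtains C where "C \<in> sccs" "u \<in> verts C"
proof -
  have "scc_of u \<in> verts ` sccs"
    using assms scc_of_in_sccs_verts sccs_verts_conv by simp
  then show ?thesis
    using assms in_scc_of_self that by (metis imageE)
qed

lemma component_nonempty:
  assumes "C \<in> sccs"
  obtains u where "u \<in> verts C" "u \<in> verts G"
proof -
  obtain u where u: "u \<in> verts C"
    using in_sccsE[OF assms] unfolding strongly_connected_def by blast
  with verts_component[OF assms u] that show ?thesis
    by blast
qed

lemma arcs_ends_component:
  assumes "C \<in> sccs"
  shows "arcs_ends C = {(u, v) \<in> arcs_ends G. u \<in> verts C \<and> v \<in> verts C}"
  using assms by (intro induced_subgraph_arcs_ends in_sccs_imp_induced)

text \<open>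
  Components are induced subgraphs and hence determined by their vertices, which form a fibre. So a
  component corresponds to the common value of the invariant on it.
\<close>

lemma components_bij_betw_range:
  "\<exists>f. bij_betw f sccs (\<phi> ` verts G) \<and> (\<forall>C\<in>sccs. \<forall>u\<in>verts C. f C = \<phi> u)"
proof (intro exI conjI ballI)
  \<comment> \<open>Components are nonempty and the invariant is constant on them, so the choice does not matter.\<close>
  let ?f = "\<lambda>C. \<phi> (SOME u. u \<in> verts C)"
  show f: "?f C = \<phi> u" if "C \<in> sccs" "u \<in> verts C" for C u
  proof -
    have "(SOME u. u \<in> verts C) \<in> verts C"
      using that(2) by (rule someI)
    then show ?thesis
      unfolding verts_component[OF that] by simp
  qed
  show "bij_betw ?f sccs (\<phi> ` verts G)"
    unfolding bij_betw_def
  proof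
    show "inj_on ?f sccs"
    proof (rule inj_onI)
      fix C D assume C: "C \<in> sccs" and D: "D \<in> sccs" and eq: "?f C = ?f D"
      obtain u where u: "u \<in> verts C"
        using C by (rule component_nonempty)
      obtain v where v: "v \<in> verts D"
        using D by (rule component_nonempty)
      have "\<phi> u = \<phi> v"
        using eq f[OF C u] f[OF D v] by simp
      then have "verts C = verts D"
        using verts_component[OF C u] verts_component[OF D v] by simp
      then show "C = D"
        using inj_on_verts_sccs C D by (auto dest: inj_onD)
    qed
    show "?f ` sccs = \<phi> ` verts G"
    proof (intro equalityI subsetI)
      fix x assume "x \<in> ?f ` sccs"
      then obtain C where C: "C \<in> sccs" and x: "x = ?f C"
        by blast
      obtain u where "u \<in> verts C" "u \<in> verts G"
        using C by (rule component_nonempty)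
      then show "x \<in> \<phi> ` verts G"
        using f[OF C] x by (simp add: image_eqI)
    next
      fix x assume "x \<in> \<phi> ` verts G"
      then obtain u where u: "u \<in> verts G" "x = \<phi> u"
        by blast
      obtain C where C: "C \<in> sccs" "u \<in> verts C"
        using u(1) by (rule component_of_vertex)
      have "x = ?f C"
        using f[OF C] u(2) by simp
      then show "x \<in> ?f ` sccs"
        using C(1) by (rule image_eqI)
    qed
  qed
qed

lemma components_complete_iff:
  "(\<forall>C\<in>sccs. complete_graph C) \<longleftrightarrow>
    (\<forall>u\<in>verts G. \<forall>v\<in>verts G. \<phi> u = \<phi> v \<longrightarrow> u \<noteq> v \<longrightarrow> u \<rightarrow>\<^bsub>G\<^esub> v)"
  (is "?L \<longleftrightarrow> ?R")
proof
  assume L: ?L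
  show ?R
  proof (intro ballI impI)
    fix u v assume uv: "u \<in> verts G" "v \<in> verts G" "\<phi> u = \<phi> v" "u \<noteq> v"
    obtain C where C: "C \<in> sccs" "u \<in> verts C"
      using component_of_vertex uv(1) .
    have "v \<in> verts C"
      using verts_component[OF C] uv by simp
    then have "(u, v) \<in> arcs_ends C"
      using L C uv(4) unfolding complete_graph_def by blast
    then show "u \<rightarrow>\<^bsub>G\<^esub> v"
      using arcs_ends_component[OF C(1)] by auto
  qed
next
  assume R: ?R
  show ?L
  proof
    fix C assume C: "C \<in> sccs"
    have "u \<rightarrow>\<^bsub>G\<^esub> v" if uv: "u \<in> verts C" "v \<in> verts C" "u \<noteq> v" for u v
    proof -
      have "u \<in> verts G" "v \<in> verts G" "\<phi> v = \<phi> u"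
        using uv(1,2) unfolding verts_component[OF C uv(1)] by auto
      then show ?thesis
        using R uv(3) by simp
    qed
    then show "complete_graph C"
      unfolding complete_graph_def arcs_ends_component[OF C] using adj_not_same by blast
  qed
qed

text \<open>
  The connecting vertex \<open>w\<close> is adjacent to \<open>u\<close>, so it lies in the fibre of \<open>u\<close>. The path
  through \<open>w\<close> thus stays inside the component, where the diameter is measured.
\<close>

lemma component_diameter_le_2:
  assumes path: "\<And>u v. \<lbrakk>u \<in> verts G; v \<in> verts G; \<phi> u = \<phi> v\<rbrakk>
      \<Longrightarrow> u = v \<or> u \<rightarrow>\<^bsub>G\<^esub> v \<or> (\<exists>w. u \<rightarrow>\<^bsub>G\<^esub> w \<and> w \<rightarrow>\<^bsub>G\<^esub> v)"
    and C: "C \<in> sccs"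
  shows "diameter C \<le> 2"
proof -
  interpret C: wf_digraph C
    using in_sccs_imp_induced[OF C] by (rule wf_digraphI_induced)
  have "C.\<mu> (\<lambda>_. 1) u v \<le> 2" if u: "u \<in> verts C" and v: "v \<in> verts C" for u v
  proof -
    note fibre = verts_component[OF C u]
    have arcC: "\<exists>e. e \<in> arcs C \<and> tail C e = x \<and> head C e = y"
      if "x \<rightarrow>\<^bsub>G\<^esub> y" "x \<in> verts C" "y \<in> verts C" for x y
    proof -
      have "(x, y) \<in> arcs_ends C"
        using that arcs_ends_component[OF C] by simp
      then show ?thesis
        by (auto simp: arcs_ends_conv)
    qed
    have "u = v \<or> u \<rightarrow>\<^bsub>G\<^esub> v \<or> (\<exists>w. u \<rightarrow>\<^bsub>G\<^esub> w \<and> w \<rightarrow>\<^bsub>G\<^esub> v)"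
      using path[of u v] u v fibre by auto
    then have "\<exists>p. C.awalk u p v \<and> length p \<le> 2"
    proof (elim disjE exE conjE)
      assume "u = v"
      then show ?thesis
        using u by (intro exI[of _ "[]"]) (simp add: C.awalk_Nil_iff)
    next
      assume "u \<rightarrow>\<^bsub>G\<^esub> v"
      then obtain e where "e \<in> arcs C" "tail C e = u" "head C e = v"
        using arcC u v by blast
      then show ?thesis
        using u v by (intro exI[of _ "[e]"]) (simp add: C.awalk_Cons_iff C.awalk_Nil_iff)
    next
      fix w assume w: "u \<rightarrow>\<^bsub>G\<^esub> w" "w \<rightarrow>\<^bsub>G\<^esub> v"
      then have wC: "w \<in> verts C"
        using fibre adj_in_verts invariant_adj by fastforce
      from arcC[OF w(1) u wC] obtain d where d: "d \<in> arcs C" "tail C d = u" "head C d = w"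
        by blast
      from arcC[OF w(2) wC v] obtain e where e: "e \<in> arcs C" "tail C e = w" "head C e = v"
        by blast
      show ?thesis
        using d e v by (intro exI[of _ "[d, e]"]) (simp add: C.awalk_Cons_iff C.awalk_Nil_iff)
    qed
    then obtain p where p: "C.awalk u p v" "length p \<le> 2"
      by blast
    have "C.\<mu> (\<lambda>_. 1) u v \<le> ereal (C.awalk_cost (\<lambda>_. 1) p)"
      using p(1) by (rule C.min_cost_le_walk_cost)
    also have "C.awalk_cost (\<lambda>_. 1) p = real (length p)"
      by (induct p) auto
    also have "ereal (real (length p)) \<le> 2"
      using p(2) by simp
    finally show ?thesis .
  qed
  then show ?thesis
    unfolding diameter_def graph_distance_def by (auto intro: SUP_least)
qed

end

section \<open>Ideal classes as orbits of dilation\<close>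

locale ring_in_quotient_field =
  fixes R K :: "('a, 'b) ring_scheme"
  assumes quotient_field: "quotient_field R K"

sublocale ring_in_quotient_field \<subseteq> K: field K
  using quotient_field by (simp add: quotient_field_def)

sublocale ring_in_quotient_field \<subseteq> R: "domain" R
proof -
  have "subring (carrier R) K" and R: "R = K\<lparr>carrier := carrier R\<rparr>"
    using quotient_field unfolding quotient_field_def by blast+
  then have "domain (K\<lparr>carrier := carrier R\<rparr>)"
    using K.subring_is_domain by blast
  then show "domain R"
    by (subst R)
qed

context ring_in_quotient_field
begin

lemma subring_carrier: "subring (carrier R) K"
  and R_eq: "R = K\<lparr>carrier := carrier R\<rparr>"
  using quotient_field unfolding quotient_field_def by blast+

lemma operations_eq [simp]:
  "(\<otimes>\<^bsub>R\<^esub>) = (\<otimes>\<^bsub>K\<^esub>)" "\<one>\<^bsub>R\<^esub> = \<one>\<^bsub>K\<^esub>" "\<zero>\<^bsub>R\<^esub> = \<zero>\<^bsub>K\<^esub>" "(\<oplus>\<^bsub>R\<^esub>) = (\<oplus>\<^bsub>K\<^esub>)"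
  using arg_cong[OF R_eq, of monoid.mult] arg_cong[OF R_eq, of monoid.one]
    arg_cong[OF R_eq, of ring.zero] arg_cong[OF R_eq, of ring.add]
  by simp_all

lemma carrier_R_subset: "carrier R \<subseteq> carrier K"
  using subring_carrier by (rule subringE)

lemma a_inv_eq: "x \<in> carrier R \<Longrightarrow> \<ominus>\<^bsub>R\<^esub> x = \<ominus>\<^bsub>K\<^esub> x"
  using K.minus_equality[of "\<ominus>\<^bsub>R\<^esub> x" x] R.l_neg[of x] R.a_inv_closed[of x] carrier_R_subset
  by (simp add: subset_eq)

lemma r_coset_eq: "I #>\<^bsub>R\<^esub> x = I #>\<^bsub>K\<^esub> x"
  by (simp add: r_coset_def)

lemma dilate_dilate:
  assumes "I \<subseteq> carrier K" "x \<in> carrier K" "y \<in> carrier K"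
  shows "(I #>\<^bsub>K\<^esub> x) #>\<^bsub>K\<^esub> y = I #>\<^bsub>K\<^esub> (x \<otimes>\<^bsub>K\<^esub> y)"
  using assms by (auto simp: r_coset_def K.m_assoc subset_eq)

lemma dilate_one: "I \<subseteq> carrier K \<Longrightarrow> I #>\<^bsub>K\<^esub> \<one>\<^bsub>K\<^esub> = I"
  by (auto simp: r_coset_def subset_eq)

lemma inv_nonzero:
  assumes "x \<in> carrier K - {\<zero>\<^bsub>K\<^esub>}"
  shows "inv\<^bsub>K\<^esub> x \<in> carrier K - {\<zero>\<^bsub>K\<^esub>}"
    and "inv\<^bsub>K\<^esub> x \<otimes>\<^bsub>K\<^esub> x = \<one>\<^bsub>K\<^esub>" "x \<otimes>\<^bsub>K\<^esub> inv\<^bsub>K\<^esub> x = \<one>\<^bsub>K\<^esub>"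
proof -
  have "x \<in> Units K"
    using assms K.field_Units by simp
  then show "inv\<^bsub>K\<^esub> x \<in> carrier K - {\<zero>\<^bsub>K\<^esub>}"
    "inv\<^bsub>K\<^esub> x \<otimes>\<^bsub>K\<^esub> x = \<one>\<^bsub>K\<^esub>" "x \<otimes>\<^bsub>K\<^esub> inv\<^bsub>K\<^esub> x = \<one>\<^bsub>K\<^esub>"
    using K.Units_inv_Units K.field_Units by auto
qed

lemma fractional_idealD:
  assumes "fractional_ideal R K I"
  shows "I \<subseteq> carrier K" "\<zero>\<^bsub>K\<^esub> \<in> I" "I \<noteq> {\<zero>\<^bsub>K\<^esub>}"
    "\<And>x y. \<lbrakk>x \<in> I; y \<in> I\<rbrakk> \<Longrightarrow> x \<oplus>\<^bsub>K\<^esub> y \<in> I"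
    "\<And>x. x \<in> I \<Longrightarrow> \<ominus>\<^bsub>K\<^esub> x \<in> I"
    "\<And>r x. \<lbrakk>r \<in> carrier R; x \<in> I\<rbrakk> \<Longrightarrow> r \<otimes>\<^bsub>K\<^esub> x \<in> I"
proof -
  interpret I: additive_subgroup I K
    using assms by (simp add: fractional_ideal_def)
  show "I \<subseteq> carrier K" "\<zero>\<^bsub>K\<^esub> \<in> I"
    "\<And>x y. \<lbrakk>x \<in> I; y \<in> I\<rbrakk> \<Longrightarrow> x \<oplus>\<^bsub>K\<^esub> y \<in> I"
    using I.a_subset by auto
  show "\<And>x. x \<in> I \<Longrightarrow> \<ominus>\<^bsub>K\<^esub> x \<in> I"
    using I.a_inv_closed K.abelian_group_axioms by blast
  show "I \<noteq> {\<zero>\<^bsub>K\<^esub>}" "\<And>r x. \<lbrakk>r \<in> carrier R; x \<in> I\<rbrakk> \<Longrightarrow> r \<otimes>\<^bsub>K\<^esub> x \<in> I"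
    using assms by (auto simp: fractional_ideal_def)
qed

text \<open>
  A finite sum of products \<open>(r x) i\<close> with \<open>r \<in> R\<close> and \<open>i \<in> I\<close> equals \<open>(\<Sum> r i) x\<close>, and the sum in
  parentheses is in the \<open>R\<close>-module \<open>I\<close>. Multiplication by principal fractional ideals is therefore
  dilation.
\<close>

lemma ideal_prod_principal:
  assumes I: "fractional_ideal R K I" and x: "x \<in> carrier K"
  shows "ideal_prod K (carrier R #>\<^bsub>K\<^esub> x) I = I #>\<^bsub>K\<^esub> x"
proof (intro equalityI subsetI)
  note I = fractional_idealD[OF I]
  fix s assume "s \<in> ideal_prod K (carrier R #>\<^bsub>K\<^esub> x) I"
  then show "s \<in> I #>\<^bsub>K\<^esub> x"
  proof induct
    case (prod i j)
    then obtain r where r: "r \<in> carrier R" "i = r \<otimes>\<^bsub>K\<^esub> x"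
      by (auto simp: r_coset_def)
    have "i \<otimes>\<^bsub>K\<^esub> j = (r \<otimes>\<^bsub>K\<^esub> j) \<otimes>\<^bsub>K\<^esub> x"
      using r prod(2) I(1) x carrier_R_subset by (simp add: subset_eq K.m_ac)
    then show ?case
      using I(6)[OF r(1) prod(2)] by (auto simp: r_coset_def)
  next
    case (sum s1 s2)
    then obtain i j where "i \<in> I" "j \<in> I" "s1 = i \<otimes>\<^bsub>K\<^esub> x" "s2 = j \<otimes>\<^bsub>K\<^esub> x"
      by (auto simp: r_coset_def)
    moreover from this have "s1 \<oplus>\<^bsub>K\<^esub> s2 = (i \<oplus>\<^bsub>K\<^esub> j) \<otimes>\<^bsub>K\<^esub> x"
      using I(1) x by (simp add: subset_eq K.l_distr)
    ultimately show ?case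
      using I(4) by (auto simp: r_coset_def)
  qed
next
  note I = fractional_idealD[OF I]
  fix s assume "s \<in> I #>\<^bsub>K\<^esub> x"
  then obtain i where i: "i \<in> I" "s = i \<otimes>\<^bsub>K\<^esub> x"
    by (auto simp: r_coset_def)
  have "x \<in> carrier R #>\<^bsub>K\<^esub> x"
    using x R.one_closed by (force simp: r_coset_def)
  then have "x \<otimes>\<^bsub>K\<^esub> i \<in> ideal_prod K (carrier R #>\<^bsub>K\<^esub> x) I"
    using i(1) by (rule ideal_prod.prod)
  then show "s \<in> ideal_prod K (carrier R #>\<^bsub>K\<^esub> x) I"
    using i I(1) x by (simp add: subset_eq K.m_comm)
qed

lemma ideal_class_eq_orbit:
  assumes "fractional_ideal R K I"
  shows "ideal_class R K I = (\<lambda>x. I #>\<^bsub>K\<^esub> x) ` (carrier K - {\<zero>\<^bsub>K\<^esub>})"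
proof -
  have "ideal_class R K I = (\<lambda>P. ideal_prod K P I) ` principal_fractional_ideals R K"
    by (auto simp: ideal_class_def fractional_ideal_group_def r_coset_def)
  also have "principal_fractional_ideals R K =
      (\<lambda>x. carrier R #>\<^bsub>K\<^esub> x) ` (carrier K - {\<zero>\<^bsub>K\<^esub>})"
    unfolding principal_fractional_ideals_def by blast
  finally show ?thesis
    using ideal_prod_principal[OF assms] by (simp add: image_image)
qed

text \<open>
  The orbit of \<open>Ix\<close> is the orbit of \<open>I\<close> since multiplication by \<open>x\<close> permutes the nonzero elements
  of the field.
\<close>

lemma ideal_class_dilate:
  assumes I: "fractional_ideal R K I" and x: "x \<in> carrier K - {\<zero>\<^bsub>K\<^esub>}"
    and Ix: "fractional_ideal R K (I #>\<^bsub>K\<^esub> x)"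
  shows "ideal_class R K (I #>\<^bsub>K\<^esub> x) = ideal_class R K I"
proof -
  note sub = fractional_idealD(1)[OF I]
  have "(\<lambda>y. x \<otimes>\<^bsub>K\<^esub> y) ` (carrier K - {\<zero>\<^bsub>K\<^esub>}) = carrier K - {\<zero>\<^bsub>K\<^esub>}"
  proof (intro equalityI subsetI)
    fix y assume y: "y \<in> carrier K - {\<zero>\<^bsub>K\<^esub>}"
    have "inv\<^bsub>K\<^esub> x \<otimes>\<^bsub>K\<^esub> y \<in> carrier K - {\<zero>\<^bsub>K\<^esub>}"
      using inv_nonzero(1)[OF x] y by (simp add: K.integral_iff)
    moreover have "y = x \<otimes>\<^bsub>K\<^esub> (inv\<^bsub>K\<^esub> x \<otimes>\<^bsub>K\<^esub> y)"
      using inv_nonzero[OF x] y x K.m_assoc[of x "inv\<^bsub>K\<^esub> x" y] by simp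
    ultimately show "y \<in> (\<lambda>y. x \<otimes>\<^bsub>K\<^esub> y) ` (carrier K - {\<zero>\<^bsub>K\<^esub>})"
      by (rule rev_image_eqI)
  qed (use x in \<open>auto simp: K.integral_iff\<close>)
  then have "ideal_class R K I =
      (\<lambda>y. I #>\<^bsub>K\<^esub> (x \<otimes>\<^bsub>K\<^esub> y)) ` (carrier K - {\<zero>\<^bsub>K\<^esub>})"
    unfolding ideal_class_eq_orbit[OF I] by (metis image_image)
  also have "\<dots> = ideal_class R K (I #>\<^bsub>K\<^esub> x)"
    unfolding ideal_class_eq_orbit[OF Ix] using sub x by (intro image_cong) (auto simp: dilate_dilate)
  finally show ?thesis
    by simp
qed

lemma ideal_class_eq_iff:
  assumes I: "fractional_ideal R K I" and J: "fractional_ideal R K J"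
  shows "ideal_class R K I = ideal_class R K J \<longleftrightarrow>
    (\<exists>k\<in>carrier K - {\<zero>\<^bsub>K\<^esub>}. I = J #>\<^bsub>K\<^esub> k)"
proof
  assume "ideal_class R K I = ideal_class R K J"
  moreover have "I \<in> ideal_class R K I"
    using dilate_one[OF fractional_idealD(1)[OF I]] K.one_closed K.one_not_zero
    unfolding ideal_class_eq_orbit[OF I] by blast
  ultimately show "\<exists>k\<in>carrier K - {\<zero>\<^bsub>K\<^esub>}. I = J #>\<^bsub>K\<^esub> k"
    unfolding ideal_class_eq_orbit[OF J] by blast
next
  assume "\<exists>k\<in>carrier K - {\<zero>\<^bsub>K\<^esub>}. I = J #>\<^bsub>K\<^esub> k"
  then show "ideal_class R K I = ideal_class R K J"
    using ideal_class_dilate[OF J] I by auto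
qed

lemma nonzero_ideal_imp_fractional:
  assumes "I \<in> nonzero_ideals R"
  shows "fractional_ideal R K I"
proof -
  interpret I: ideal I R
    using assms by (simp add: nonzero_ideals_def)
  have "subgroup I (add_monoid K)"
  proof (rule K.add.subgroupI)
    show "I \<subseteq> carrier K"
      using I.a_subset carrier_R_subset by blast
    show "\<ominus>\<^bsub>K\<^esub> x \<in> I" if "x \<in> I" for x
      using that I.a_inv_closed[OF that] a_inv_eq[of x] I.a_subset by auto
    show "x \<oplus>\<^bsub>K\<^esub> y \<in> I" if "x \<in> I" "y \<in> I" for x y
      using I.a_closed[OF that] by simp
  qed (use I.zero_closed in blast)
  moreover have "r \<otimes>\<^bsub>K\<^esub> x \<in> I" if "r \<in> carrier R" "x \<in> I" for r x
    using I.I_l_closed[OF that(2,1)] by simp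
  moreover have "\<exists>d\<in>carrier R - {\<zero>\<^bsub>R\<^esub>}. \<forall>x\<in>I. d \<otimes>\<^bsub>K\<^esub> x \<in> carrier R"
    using I.a_subset R.one_closed carrier_R_subset by (intro bexI[of _ "\<one>\<^bsub>R\<^esub>"]) auto
  ultimately show ?thesis
    using assms by (simp add: fractional_ideal_def nonzero_ideals_def additive_subgroupI)
qed

text \<open>
  This covers two cases: clearing the denominators of a fractional ideal, and multiplying an ideal of
  \<open>R\<close> by an element of \<open>R\<close>.
\<close>

lemma integral_dilate_is_nonzero_ideal:
  assumes I: "fractional_ideal R K I" and x: "x \<in> carrier K - {\<zero>\<^bsub>K\<^esub>}"
    and sub: "I #>\<^bsub>K\<^esub> x \<subseteq> carrier R"
  shows "I #>\<^bsub>K\<^esub> x \<in> nonzero_ideals R"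
proof -
  note I = fractional_idealD[OF I]
  have mem: "\<And>y. y \<in> I #>\<^bsub>K\<^esub> x \<longleftrightarrow> (\<exists>i\<in>I. y = i \<otimes>\<^bsub>K\<^esub> x)"
    by (auto simp: r_coset_def)
  have mult: "r \<otimes>\<^bsub>K\<^esub> y \<in> I #>\<^bsub>K\<^esub> x" if r: "r \<in> carrier R" and y: "y \<in> I #>\<^bsub>K\<^esub> x" for r y
  proof -
    obtain i where i: "i \<in> I" "y = i \<otimes>\<^bsub>K\<^esub> x"
      using y unfolding mem by blast
    then have "r \<otimes>\<^bsub>K\<^esub> y = (r \<otimes>\<^bsub>K\<^esub> i) \<otimes>\<^bsub>K\<^esub> x"
      using r I(1) x carrier_R_subset by (simp add: subset_eq K.m_assoc)
    then show ?thesis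
      using I(6)[OF r i(1)] by (auto simp: mem)
  qed
  have "ideal (I #>\<^bsub>K\<^esub> x) R"
  proof (rule idealI)
    show "subgroup (I #>\<^bsub>K\<^esub> x) (add_monoid R)"
    proof (rule R.add.subgroupI)
      show "I #>\<^bsub>K\<^esub> x \<noteq> {}"
        using I(2) by (auto simp: r_coset_def)
      show "\<ominus>\<^bsub>R\<^esub> y \<in> I #>\<^bsub>K\<^esub> x" if y: "y \<in> I #>\<^bsub>K\<^esub> x" for y
      proof -
        obtain i where i: "i \<in> I" "y = i \<otimes>\<^bsub>K\<^esub> x"
          using y unfolding mem by blast
        then have "\<ominus>\<^bsub>R\<^esub> y = (\<ominus>\<^bsub>K\<^esub> i) \<otimes>\<^bsub>K\<^esub> x"
          using I(1) x sub y a_inv_eq[of y] by (simp add: subset_eq K.l_minus)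
        then show ?thesis
          using I(5)[OF i(1)] by (auto simp: mem)
      qed
      show "y \<oplus>\<^bsub>R\<^esub> z \<in> I #>\<^bsub>K\<^esub> x" if yz: "y \<in> I #>\<^bsub>K\<^esub> x" "z \<in> I #>\<^bsub>K\<^esub> x" for y z
      proof -
        obtain i j where ij: "i \<in> I" "y = i \<otimes>\<^bsub>K\<^esub> x" "j \<in> I" "z = j \<otimes>\<^bsub>K\<^esub> x"
          using yz unfolding mem by blast
        then have "y \<oplus>\<^bsub>K\<^esub> z = (i \<oplus>\<^bsub>K\<^esub> j) \<otimes>\<^bsub>K\<^esub> x"
          using I(1) x by (simp add: subset_eq K.l_distr)
        then show ?thesis
          using I(4)[OF ij(1,3)] by (auto simp: mem)
      qed
    qed (rule sub)
    show "r \<otimes>\<^bsub>R\<^esub> y \<in> I #>\<^bsub>K\<^esub> x" if "y \<in> I #>\<^bsub>K\<^esub> x" "r \<in> carrier R" for y r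
      using mult that by simp
    show "y \<otimes>\<^bsub>R\<^esub> r \<in> I #>\<^bsub>K\<^esub> x" if "y \<in> I #>\<^bsub>K\<^esub> x" "r \<in> carrier R" for y r
      using mult[OF that(2,1)] R.m_comm[of y r] sub that by auto
  qed (rule R.ring_axioms)
  moreover have "I #>\<^bsub>K\<^esub> x \<noteq> {\<zero>\<^bsub>R\<^esub>}"
  proof -
    obtain i where i: "i \<in> I" "i \<noteq> \<zero>\<^bsub>K\<^esub>"
      using I(2,3) by auto
    then have "i \<otimes>\<^bsub>K\<^esub> x \<noteq> \<zero>\<^bsub>K\<^esub>"
      using x I(1) by (auto simp: K.integral_iff subset_eq)
    then show ?thesis
      using i(1) mem[of "i \<otimes>\<^bsub>K\<^esub> x"] by auto
  qed
  ultimately show ?thesis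
    by (simp add: nonzero_ideals_def)
qed

lemma nonzero_ideal_dilate:
  assumes I: "I \<in> nonzero_ideals R" and a: "a \<in> carrier R - {\<zero>\<^bsub>R\<^esub>}"
  shows "I #>\<^bsub>K\<^esub> a \<in> nonzero_ideals R"
proof (rule integral_dilate_is_nonzero_ideal)
  interpret I: ideal I R
    using I by (simp add: nonzero_ideals_def)
  show "I #>\<^bsub>K\<^esub> a \<subseteq> carrier R"
    using R.m_closed I.a_subset a by (auto simp: r_coset_def)
qed (use assms carrier_R_subset in \<open>auto intro: nonzero_ideal_imp_fractional\<close>)

lemma nonzero_ideal_class_eq_iff:
  assumes "I \<in> nonzero_ideals R" "J \<in> nonzero_ideals R"
  shows "ideal_class R K I = ideal_class R K J \<longleftrightarrow>
    (\<exists>k\<in>carrier K - {\<zero>\<^bsub>K\<^esub>}. I = J #>\<^bsub>K\<^esub> k)"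
  using assms by (intro ideal_class_eq_iff nonzero_ideal_imp_fractional)

text \<open>
  If \<open>d\<close> is a common denominator of the fractional ideal \<open>I\<close>, then \<open>Id\<close> is an ideal of \<open>R\<close> in the
  class of \<open>I\<close>.
\<close>

lemma carrier_class_group: "carrier (class_group R K) = ideal_class R K ` nonzero_ideals R"
proof -
  have "carrier (class_group R K) = ideal_class R K ` {I. fractional_ideal R K I}"
    unfolding class_group_def FactGroup_def RCOSETS_def ideal_class_def
    by (auto simp: fractional_ideal_group_def)
  also have "\<dots> = ideal_class R K ` nonzero_ideals R"
  proof (intro equalityI subsetI)
    fix c assume "c \<in> ideal_class R K ` {I. fractional_ideal R K I}"
    then obtain I where I: "fractional_ideal R K I" and c: "c = ideal_class R K I"
      by blast
    obtain d where d: "d \<in> carrier R - {\<zero>\<^bsub>R\<^esub>}" "\<forall>x\<in>I. d \<otimes>\<^bsub>K\<^esub> x \<in> carrier R"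
      using I by (auto simp: fractional_ideal_def)
    have dK: "d \<in> carrier K - {\<zero>\<^bsub>K\<^esub>}"
      using d(1) carrier_R_subset by auto
    have "I #>\<^bsub>K\<^esub> d \<subseteq> carrier R"
      using d(2) dK fractional_idealD(1)[OF I] by (auto simp: r_coset_def K.m_comm subset_eq)
    then have Id: "I #>\<^bsub>K\<^esub> d \<in> nonzero_ideals R"
      using I dK by (intro integral_dilate_is_nonzero_ideal)
    then show "c \<in> ideal_class R K ` nonzero_ideals R"
      using ideal_class_dilate[OF I dK] nonzero_ideal_imp_fractional c by blast
  qed (use nonzero_ideal_imp_fractional in blast)
  finally show ?thesis .
qed

section \<open>The two graphs\<close>

lemma GCl_adj_iff:
  "I \<rightarrow>\<^bsub>GCl R K\<^esub> J \<longleftrightarrow>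
    I \<in> nonzero_ideals R \<and> J \<in> nonzero_ideals R \<and> I \<noteq> J \<and> ideal_class R K I = ideal_class R K J"
  unfolding GCl_def with_proj_simps using nonzero_ideal_class_eq_iff by auto

lemma GCl_int_adj_iff:
  "I \<rightarrow>\<^bsub>GCl_int R\<^esub> J \<longleftrightarrow>
    I \<in> nonzero_ideals R \<and> J \<in> nonzero_ideals R \<and> I \<noteq> J \<and>
    (\<exists>a\<in>carrier R - {\<zero>\<^bsub>R\<^esub>}. I = J #>\<^bsub>K\<^esub> a \<or> J = I #>\<^bsub>K\<^esub> a)"
  unfolding GCl_int_def with_proj_simps by (auto simp: r_coset_eq)

text \<open>
  Writing \<open>I = Jk\<close> with \<open>k = a/b\<close>, the ideal \<open>L = Ib = Ja\<close> is a multiple of both \<open>I\<close> and \<open>J\<close>. The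
  shorter paths occur when \<open>L\<close> is \<open>I\<close> or \<open>J\<close>.
\<close>

lemma GCl_int_path:
  assumes I: "I \<in> nonzero_ideals R" and J: "J \<in> nonzero_ideals R"
    and eq: "ideal_class R K I = ideal_class R K J"
  shows "I = J \<or> I \<rightarrow>\<^bsub>GCl_int R\<^esub> J \<or> (\<exists>L. I \<rightarrow>\<^bsub>GCl_int R\<^esub> L \<and> L \<rightarrow>\<^bsub>GCl_int R\<^esub> J)"
proof -
  obtain k where k: "k \<in> carrier K - {\<zero>\<^bsub>K\<^esub>}" "I = J #>\<^bsub>K\<^esub> k"
    using eq nonzero_ideal_class_eq_iff[OF I J] by blast
  obtain a b where ab: "a \<in> carrier R" "b \<in> carrier R - {\<zero>\<^bsub>K\<^esub>}" "k = a \<otimes>\<^bsub>K\<^esub> inv\<^bsub>K\<^esub> b"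
    using quotient_field k(1) unfolding quotient_field_def by blast
  have bK: "b \<in> carrier K - {\<zero>\<^bsub>K\<^esub>}" and aK: "a \<in> carrier K"
    using ab carrier_R_subset by auto
  have a: "a \<in> carrier R - {\<zero>\<^bsub>R\<^esub>}"
    using ab k(1) inv_nonzero(1)[OF bK] by auto
  have "k \<otimes>\<^bsub>K\<^esub> b = a"
    using ab(3) inv_nonzero[OF bK] bK aK by (simp add: K.m_assoc)
  then have Ib: "I #>\<^bsub>K\<^esub> b = J #>\<^bsub>K\<^esub> a"
    using k bK dilate_dilate[OF fractional_idealD(1)[OF nonzero_ideal_imp_fractional[OF J]]]
    by simp
  define L where "L = J #>\<^bsub>K\<^esub> a"
  have "L \<in> nonzero_ideals R"
    unfolding L_def using J a by (rule nonzero_ideal_dilate)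
  then have "I = L \<or> I \<rightarrow>\<^bsub>GCl_int R\<^esub> L" "J = L \<or> L \<rightarrow>\<^bsub>GCl_int R\<^esub> J"
    using I J a ab(2) Ib[symmetric] unfolding GCl_int_adj_iff L_def operations_eq by blast+
  then show ?thesis
    by blast
qed

lemma verts_GCl: "verts (GCl R K) = nonzero_ideals R"
  and verts_GCl_int: "verts (GCl_int R) = nonzero_ideals R"
  by (simp_all add: GCl_def GCl_int_def)

sublocale GCl: digraph_with_invariant "GCl R K" "ideal_class R K"
proof -
  interpret wf_digraph "GCl R K"
    by unfold_locales (auto simp: GCl_def)
  show "digraph_with_invariant (GCl R K) (ideal_class R K)"
  proof unfold_locales
    show "I \<rightarrow>\<^sup>*\<^bsub>GCl R K\<^esub> J" if "I \<in> verts (GCl R K)" "J \<in> verts (GCl R K)"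
      "ideal_class R K I = ideal_class R K J" for I J
      using that GCl_adj_iff[of I J] unfolding verts_GCl by (cases "I = J") (auto simp: verts_GCl)
  qed (auto simp: GCl_adj_iff, auto simp: GCl_def)
qed

sublocale GCl_int: digraph_with_invariant "GCl_int R" "ideal_class R K"
proof -
  interpret wf_digraph "GCl_int R"
    by unfold_locales (auto simp: GCl_int_def)
  show "digraph_with_invariant (GCl_int R) (ideal_class R K)"
  proof unfold_locales
    show "I \<rightarrow>\<^sup>*\<^bsub>GCl_int R\<^esub> J" if IJ: "I \<in> verts (GCl_int R)" "J \<in> verts (GCl_int R)"
      "ideal_class R K I = ideal_class R K J" for I J
      using GCl_int_path[of I J] IJ reachable_adjI reachable_trans unfolding verts_GCl_int
      by (metis reachable_refl verts_GCl_int)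
    show "ideal_class R K I = ideal_class R K J" if adj: "I \<rightarrow>\<^bsub>GCl_int R\<^esub> J" for I J
    proof -
      have "(\<exists>k\<in>carrier K - {\<zero>\<^bsub>K\<^esub>}. I = J #>\<^bsub>K\<^esub> k) \<or> (\<exists>k\<in>carrier K - {\<zero>\<^bsub>K\<^esub>}. J = I #>\<^bsub>K\<^esub> k)"
        using adj carrier_R_subset unfolding GCl_int_adj_iff operations_eq by blast
      then show ?thesis
        using adj nonzero_ideal_class_eq_iff unfolding GCl_int_adj_iff by metis
    qed
  qed (auto simp: GCl_int_def)
qed

end

section \<open>Noetherian domains in which divisibility is total\<close>

text \<open>
  Zorn's lemma applies to the proper ideals above \<open>I\<close>: in a noetherian ring the union of a nonempty
  chain of ideals is a member of the chain, hence proper.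
\<close>

lemma (in noetherian_ring) proper_ideal_in_maximal:
  assumes "ideal I R" "I \<noteq> carrier R"
  obtains M where "maximalideal M R" "I \<subseteq> M"
proof -
  define A where "A = {J. ideal J R \<and> I \<subseteq> J \<and> J \<noteq> carrier R}"
  have "\<exists>M\<in>A. \<forall>N\<in>A. M \<subseteq> N \<longrightarrow> N = M"
  proof (rule subset_Zorn_nonempty)
    fix C assume C: "C \<noteq> {}" "subset.chain A C"
    have "C \<subseteq> A"
      using C(2) by (simp add: subset_chain_def)
    moreover have "A \<subseteq> {J. ideal J R}"
      by (auto simp: A_def)
    ultimately have "subset.chain {J. ideal J R} C"
      using C(2) by (simp add: subset_chain_def)
    then have "\<Union>C \<in> C"
      using C(1) by (intro ideal_chain_is_trivial)
    then show "\<Union>C \<in> A"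
      using \<open>C \<subseteq> A\<close> by (rule rev_subsetD)
  qed (use assms in \<open>auto simp: A_def\<close>)
  then obtain M where M: "M \<in> A" and max: "\<And>N. \<lbrakk>N \<in> A; M \<subseteq> N\<rbrakk> \<Longrightarrow> N = M"
    by blast
  have "maximalideal M R"
  proof (rule maximalidealI)
    show "ideal M R" "carrier R \<noteq> M"
      using M by (auto simp: A_def)
    fix J assume "ideal J R" "M \<subseteq> J"
    then show "J = M \<or> J = carrier R"
      using M max[of J] by (auto simp: A_def)
  qed
  moreover have "I \<subseteq> M"
    using M by (simp add: A_def)
  ultimately show ?thesis
    by (rule that)
qed

text \<open>
  The principal ideals generated by the elements of \<open>I\<close> form a chain with union \<open>I\<close>, and in a
  noetherian ring the union of a nonempty chain of ideals belongs to the chain.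
\<close>

lemma (in noetherian_domain) principal_if_divides_total:
  assumes total: "\<And>a b. \<lbrakk>a \<in> carrier R; b \<in> carrier R\<rbrakk> \<Longrightarrow> a divides b \<or> b divides a"
  shows "principal_domain R"
proof unfold_locales
  fix I assume I: "ideal I R"
  interpret I: ideal I R
    by (rule I)
  have carr: "a \<in> carrier R" if "a \<in> I" for a
    using that I.a_subset by blast
  let ?C = "(\<lambda>a. PIdl a) ` I"
  have "subset.chain {J. ideal J R} ?C"
    unfolding subset_chain_def
  proof (intro conjI ballI)
    show "?C \<subseteq> {J. ideal J R}"
      using carr cgenideal_ideal by auto
    fix S T assume "S \<in> ?C" "T \<in> ?C"
    then obtain a b where "a \<in> carrier R" "S = PIdl a" "b \<in> carrier R" "T = PIdl b"
      using carr by blast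
    then show "S \<subseteq> T \<or> T \<subseteq> S"
      using total[of a b] to_contain_is_to_divide by auto
  qed
  moreover have "?C \<noteq> {}"
    using I.zero_closed by blast
  ultimately have "\<Union>?C \<in> ?C"
    by (intro ideal_chain_is_trivial)
  moreover have "\<Union>?C = I"
    using cgenideal_self[OF carr] cgenideal_minimal[OF I] by blast
  ultimately show "\<exists>a\<in>carrier R. I = PIdl a"
    using carr by (metis imageE)
qed

text \<open>
  Maximal ideals are principal here, hence comparable, and comparable maximal ideals are equal.
\<close>

lemma (in noetherian_domain) local_if_divides_total:
  assumes total: "\<And>a b. \<lbrakk>a \<in> carrier R; b \<in> carrier R\<rbrakk> \<Longrightarrow> a divides b \<or> b divides a"
  shows "local_ring R"
proof -
  interpret principal_domain R
    using total by (rule principal_if_divides_total)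
  obtain M where M: "maximalideal M R"
    using proper_ideal_in_maximal[OF zeroideal] one_closed one_not_zero by (metis singletonD)
  have "N = M" if N: "maximalideal N R" for N
  proof -
    interpret M: maximalideal M R by (rule M)
    interpret N: maximalideal N R by (rule N)
    obtain m n where "m \<in> carrier R" "M = PIdl m" "n \<in> carrier R" "N = PIdl n"
      using exists_gen[OF M.is_ideal] exists_gen[OF N.is_ideal] by blast
    then have "M \<subseteq> N \<or> N \<subseteq> M"
      using total to_contain_is_to_divide by metis
    then show "N = M"
      using M.I_maximal[OF N.is_ideal] N.I_maximal[OF M.is_ideal] M.I_notcarr N.I_notcarr
        M.a_subset N.a_subset by blast
  qed
  with M show ?thesis
    unfolding local_ring_def using cring_axioms by blast
qed

text \<open>
  If \<open>a\<close> and \<open>b\<close> are not both zero, divide them by a generator \<open>d\<close> of the ideal that they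
  span. The quotients \<open>u\<close> and \<open>v\<close> span
  the unit ideal, so they are not both in the maximal ideal \<open>M\<close>. In a local ring the elements
  outside \<open>M\<close> are units, so \<open>u\<close> or \<open>v\<close> is a unit, and then \<open>a\<close> or \<open>b\<close> is associated to \<open>d\<close>,
  which divides the other.
\<close>

lemma (in principal_domain) divides_total_if_local:
  assumes local: "local_ring R" and a: "a \<in> carrier R" and b: "b \<in> carrier R"
  shows "a divides b \<or> b divides a"
proof (cases "a = \<zero> \<and> b = \<zero>")
  case True
  then show ?thesis
    using divides_zero by blast
next
  case False
  obtain d where d: "d \<in> carrier R" and sum: "PIdl a <+>\<^bsub>R\<^esub> PIdl b = PIdl d"
    using exists_gen[OF add_ideals[OF cgenideal_ideal[OF a] cgenideal_ideal[OF b]]] by blast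
  have mem_sum: "x \<in> PIdl d \<longleftrightarrow> (\<exists>r\<in>carrier R. \<exists>s\<in>carrier R. x = r \<otimes> a \<oplus> s \<otimes> b)" for x
  proof -
    have "x \<in> PIdl d \<longleftrightarrow> (\<exists>y\<in>PIdl a. \<exists>z\<in>PIdl b. x = y \<oplus> z)"
      unfolding sum[symmetric] by (auto simp: set_add_def')
    then show ?thesis
      unfolding cgenideal_def by auto
  qed
  have "a \<in> PIdl d"
    unfolding mem_sum using a b by (intro bexI[of _ \<one>] bexI[of _ \<zero>]) auto
  moreover have "b \<in> PIdl d"
    unfolding mem_sum using a b by (intro bexI[of _ \<zero>] bexI[of _ \<one>]) auto
  ultimately obtain u v where u: "u \<in> carrier R" "a = u \<otimes> d" and v: "v \<in> carrier R" "b = v \<otimes> d"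
    unfolding cgenideal_def by blast
  have "d \<noteq> \<zero>"
    using False u v by auto
  obtain r s where r: "r \<in> carrier R" and s: "s \<in> carrier R" and "d = r \<otimes> a \<oplus> s \<otimes> b"
    using mem_sum[of d] cgenideal_self[OF d] by blast
  then have "\<one> \<otimes> d = (r \<otimes> u \<oplus> s \<otimes> v) \<otimes> d"
    using u v d by (simp add: m_assoc l_distr)
  then have one: "\<one> = r \<otimes> u \<oplus> s \<otimes> v"
    using m_rcancel[OF \<open>d \<noteq> \<zero>\<close> d, of \<one> "r \<otimes> u \<oplus> s \<otimes> v"] r s u(1) v(1) by simp
  obtain M where M: "maximalideal M R" and uniq: "\<And>N. maximalideal N R \<Longrightarrow> N = M"
    using local unfolding local_ring_def by blast
  interpret M: maximalideal M R
    by (rule M)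
  have nonunit: "x \<in> M" if x: "x \<in> carrier R" "x \<notin> Units R" for x
  proof -
    have "PIdl x \<noteq> carrier R"
      using ideal_eq_carrier_iff[OF x(1)] x(2) by simp
    then show ?thesis
      using proper_ideal_in_maximal[OF cgenideal_ideal[OF x(1)]] uniq cgenideal_self[OF x(1)]
      by blast
  qed
  have "\<one> \<notin> M"
    using M.one_imp_carrier M.I_notcarr by blast
  then have "u \<in> Units R \<or> v \<in> Units R"
    using nonunit[OF u(1)] nonunit[OF v(1)] M.I_l_closed r s one M.a_closed by metis
  then show ?thesis
  proof
    assume "u \<in> Units R"
    then have "b = a \<otimes> (inv u \<otimes> v)"
      using u v d by (simp add: m_ac)
    then show ?thesis
      using \<open>u \<in> Units R\<close> v(1) by (intro disjI1 dividesI[of "inv u \<otimes> v"]) auto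
  next
    assume "v \<in> Units R"
    then have "a = b \<otimes> (inv v \<otimes> u)"
      using u v d by (simp add: m_ac)
    then show ?thesis
      using \<open>v \<in> Units R\<close> u(1) by (intro disjI2 dividesI[of "inv v \<otimes> u"]) auto
  qed
qed

section \<open>Completeness of the integral graph\<close>

context ring_in_quotient_field
begin

lemma principal_ideal_eq_dilate: "PIdl\<^bsub>R\<^esub> a = carrier R #>\<^bsub>K\<^esub> a"
  using R.cgenideal_eq_rcos[of a] by (simp add: r_coset_eq)

lemma carrier_nonzero_ideal: "carrier R \<in> nonzero_ideals R"
  using R.oneideal R.one_closed R.one_not_zero by (auto simp: nonzero_ideals_def)

lemma principal_dilate:
  assumes "a \<in> carrier R" "b \<in> carrier R"
  shows "PIdl\<^bsub>R\<^esub> a #>\<^bsub>K\<^esub> b = PIdl\<^bsub>R\<^esub> (a \<otimes>\<^bsub>K\<^esub> b)"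
  using assms carrier_R_subset unfolding principal_ideal_eq_dilate by (intro dilate_dilate) auto

text \<open>
  For nonzero \<open>a\<close> and \<open>b\<close>, the ideals \<open>Ra\<close> and \<open>Rb\<close> are dilates of \<open>R\<close> and lie in one component.
  Completeness makes them equal or adjacent, and adjacent ideals of \<open>GCl_int\<close> are nested.
\<close>

lemma divides_total_if_GCl_int_complete:
  assumes complete: "\<forall>C\<in>components (GCl_int R). complete_graph C"
    and a: "a \<in> carrier R" and b: "b \<in> carrier R"
  shows "a divides\<^bsub>R\<^esub> b \<or> b divides\<^bsub>R\<^esub> a"
proof (cases "a = \<zero>\<^bsub>R\<^esub> \<or> b = \<zero>\<^bsub>R\<^esub>")
  case True
  then show ?thesis
    using a b R.divides_zero by blast
next
  case False
  have nz: "PIdl\<^bsub>R\<^esub> x \<in> nonzero_ideals R"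
    and cl: "ideal_class R K (PIdl\<^bsub>R\<^esub> x) = ideal_class R K (carrier R)"
    if x: "x \<in> carrier R - {\<zero>\<^bsub>R\<^esub>}" for x
  proof -
    show nz: "PIdl\<^bsub>R\<^esub> x \<in> nonzero_ideals R"
      using nonzero_ideal_dilate[OF carrier_nonzero_ideal x] principal_ideal_eq_dilate by simp
    have "x \<in> carrier K - {\<zero>\<^bsub>K\<^esub>}"
      using x carrier_R_subset by auto
    then show "ideal_class R K (PIdl\<^bsub>R\<^esub> x) = ideal_class R K (carrier R)"
      using nonzero_ideal_class_eq_iff[OF nz carrier_nonzero_ideal] principal_ideal_eq_dilate by blast
  qed
  have ab: "a \<in> carrier R - {\<zero>\<^bsub>R\<^esub>}" "b \<in> carrier R - {\<zero>\<^bsub>R\<^esub>}"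
    using False a b by auto
  have sub: "PIdl\<^bsub>R\<^esub> x #>\<^bsub>K\<^esub> c \<subseteq> PIdl\<^bsub>R\<^esub> x" if "x \<in> carrier R" "c \<in> carrier R" for x c
    using R.to_contain_is_to_divide[of x "x \<otimes>\<^bsub>K\<^esub> c"] principal_dilate[OF that] that
      R.m_closed[OF that] by (auto simp: factor_def)
  have "PIdl\<^bsub>R\<^esub> a = PIdl\<^bsub>R\<^esub> b \<or> (PIdl\<^bsub>R\<^esub> a) \<rightarrow>\<^bsub>GCl_int R\<^esub> (PIdl\<^bsub>R\<^esub> b)"
    using complete nz[OF ab(1)] nz[OF ab(2)] cl[OF ab(1)] cl[OF ab(2)]
    unfolding GCl_int.components_complete_iff verts_GCl_int by metis
  then have "PIdl\<^bsub>R\<^esub> a \<subseteq> PIdl\<^bsub>R\<^esub> b \<or> PIdl\<^bsub>R\<^esub> b \<subseteq> PIdl\<^bsub>R\<^esub> a"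
    using sub[OF a] sub[OF b] unfolding GCl_int_adj_iff by (metis DiffD1 subset_refl)
  then show ?thesis
    using R.to_contain_is_to_divide a b by blast
qed

text \<open>
  With all ideals principal, an edge between \<open>I = Ra\<close> and \<open>J = Rb\<close> comes from \<open>a\<close> dividing \<open>b\<close> or
  conversely. The cofactor is nonzero because \<open>I\<close> and \<open>J\<close> are.
\<close>

lemma GCl_int_complete_if_divides_total:
  assumes "principal_domain R"
    and total: "\<And>a b. \<lbrakk>a \<in> carrier R; b \<in> carrier R\<rbrakk> \<Longrightarrow> a divides\<^bsub>R\<^esub> b \<or> b divides\<^bsub>R\<^esub> a"
  shows "\<forall>C\<in>components (GCl_int R). complete_graph C"
  unfolding GCl_int.components_complete_iff verts_GCl_int
proof (intro ballI impI)
  fix I J assume I: "I \<in> nonzero_ideals R" and J: "J \<in> nonzero_ideals R" and "I \<noteq> J"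
  have multiple: "\<exists>c\<in>carrier R - {\<zero>\<^bsub>R\<^esub>}. PIdl\<^bsub>R\<^esub> b = PIdl\<^bsub>R\<^esub> a #>\<^bsub>K\<^esub> c"
    if ab: "a \<in> carrier R" "a divides\<^bsub>R\<^esub> b" and nz: "PIdl\<^bsub>R\<^esub> b \<in> nonzero_ideals R" for a b
  proof -
    obtain c where c: "c \<in> carrier R" "b = a \<otimes>\<^bsub>K\<^esub> c"
      using ab(2) by (auto simp: factor_def)
    have "PIdl\<^bsub>R\<^esub> \<zero>\<^bsub>R\<^esub> = {\<zero>\<^bsub>R\<^esub>}"
      using R.genideal_zero R.cgenideal_eq_genideal[OF R.zero_closed] by simp
    then have "b \<noteq> \<zero>\<^bsub>R\<^esub>"
      using nz by (auto simp: nonzero_ideals_def)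
    then have "c \<noteq> \<zero>\<^bsub>R\<^esub>"
      using c ab(1) R.r_null[OF ab(1)] by auto
    then show ?thesis
      using c principal_dilate[OF ab(1) c(1)] by auto
  qed
  obtain a b where a: "a \<in> carrier R" "I = PIdl\<^bsub>R\<^esub> a" and b: "b \<in> carrier R" "J = PIdl\<^bsub>R\<^esub> b"
    using principal_domain.exists_gen[OF assms(1)] I J unfolding nonzero_ideals_def by blast
  have "\<exists>c\<in>carrier R - {\<zero>\<^bsub>R\<^esub>}. I = J #>\<^bsub>K\<^esub> c \<or> J = I #>\<^bsub>K\<^esub> c"
    using total[OF a(1) b(1)] multiple I J a b by metis
  then show "I \<rightarrow>\<^bsub>GCl_int R\<^esub> J"
    using I J \<open>I \<noteq> J\<close> unfolding GCl_int_adj_iff by blast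
qed

lemma GCl_int_complete_iff:
  assumes "noetherian_domain R"
  shows "(\<forall>C\<in>components (GCl_int R). complete_graph C) \<longleftrightarrow> principal_domain R \<and> local_ring R"
  using divides_total_if_GCl_int_complete GCl_int_complete_if_divides_total
    noetherian_domain.principal_if_divides_total[OF assms]
    noetherian_domain.local_if_divides_total[OF assms]
    principal_domain.divides_total_if_local
  by metis

end

theorem theorem4p4:
  fixes R K :: "('a, 'b) ring_scheme"
  assumes "quotient_field R K"
    and "dedekind_domain R K"
  shows
    "(\<exists>f. bij_betw f (components (GCl R K)) (carrier (class_group R K)) \<and>
          (\<forall>C\<in>components (GCl R K). \<forall>I\<in>verts C. f C = ideal_class R K I)) \<and>
     (\<exists>f. bij_betw f (components (GCl_int R)) (carrier (class_group R K)) \<and>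
          (\<forall>C\<in>components (GCl_int R). \<forall>I\<in>verts C. f C = ideal_class R K I)) \<and>
     (\<forall>C\<in>components (GCl R K). complete_graph C) \<and>
     (\<forall>C\<in>components (GCl_int R). diameter C \<le> 2) \<and>
     ((\<forall>C\<in>components (GCl_int R). complete_graph C) \<longleftrightarrow> principal_domain R \<and> local_ring R)"
proof -
  interpret ring_in_quotient_field R K
    using assms(1) by unfold_locales
  have "noetherian_domain R"
    using assms(2) by (simp add: dedekind_domain_def)
  note int_complete = GCl_int_complete_iff[OF this]
  have "\<forall>C\<in>components (GCl R K). complete_graph C"
    unfolding GCl.components_complete_iff by (simp add: GCl_adj_iff verts_GCl)
  moreover have "\<forall>C\<in>components (GCl_int R). diameter C \<le> 2"
    using GCl_int.component_diameter_le_2 GCl_int_path unfolding verts_GCl_int by blast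
  ultimately show ?thesis
    using GCl.components_bij_betw_range GCl_int.components_bij_betw_range int_complete
    unfolding verts_GCl verts_GCl_int carrier_class_group by blast
qed

end
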